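(* Let $I_0$ be an instance, $\Sigma_{\mathrm{UID}}$ a transitively closed set of unary inclusion dependencies, and $n\in\mathbb{N}$. For any two elements $a$ and $b$ of $\mathrm{chase}(I_0,\Sigma_{\mathrm{UID}})$ introduced at positions $R^p$ and $S^q$ respectively, with $R^p\sim_{\mathrm{ID}} S^q$, if $a$ and $b$ are both $n$-reversible then $a\simeq_n b$ in $\mathrm{chase}(I_0,\Sigma_{\mathrm{UID}})$.
   Context: A UID $R^p\subseteq S^q$ ($R^p\neq S^q$) states that every element at position $R^p$ also occurs at position $S^q$. $\Sigma_{\mathrm{UID}}$ is transitively closed if whenever $R^p\subseteq S^q$ and $S^q\subseteq T^r$ are in it and $R^p\neq T^r$, then $R^p\subseteq T^r$ is in it. A UID $\tau:R^p\subseteq S^q$ is reversible if its reverse $S^q\subseteq R^p$ is also in $\Sigma_{\mathrm{UID}}$. $R^p\sim_{\mathrm{ID}}S^q$ iff $R^p=S^q$ or both $R^p\subseteq S^q$ and $S^q\subseteq R^p$ are in $\Sigma_{\mathrm{UID}}$. The chase $\mathrm{chase}(I_0,\Sigma_{\mathrm{UID}})$: an element $a$ at position $R^p$ with $a$ not at $S^q$, for $\tau:R^p\subseteq S^q\in\Sigma_{\mathrm{UID}}$, makes $\tau$ applicable; applying it to the fact $F'$ containing $a$ at $R^p$ adds a new fact $S(\mathbf b)$ with $b_q=a$ (the exported element, at the exported position) and fresh nulls at all other positions; these nulls are said to be introduced at their positions in this fact, $F'$ is the parent of the new fact, and $\tau$ is the last UID of each such introduced element. Chase rounds apply all applicable steps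 simultaneously with distinct fresh nulls, except that in the first round only one new fact is kept per pair (exported element, exported position); the chase is the union over all rounds. The last $n$ UIDs of an introduced element $c$ are $\tau_1,\dots,\tau_n$ where $\tau_1$ is the last UID of $c$ and $\tau_{i+1}$ is the last UID of the exported element of the fact in which the element with last UID $\tau_i$ was introduced (defined only if these elements are themselves introduced, not in $I_0$). An element is $n$-reversible if its last $n$ UIDs are defined and all reversible. For instances $I,I'$ and $a\in\mathrm{dom}(I)$, $b\in\mathrm{dom}(I')$: $(I,a)\le_0(I',b)$ always; $(I,a)\le_m(I',b)$ iff for every fact $R(\mathbf a)$ of $I$ and position $p$ with $a_p=a$ there is a fact $R(\mathbf b)$ of $I'$ with $b_p=b$ and $(I,a_j)\le_{m-1}(I',b_j)$ for all $j$. In one instance $I$, $a\simeq_m b$ iff $(I,a)\le_m(I,b)$ and $(I,b)\le_m(I,a)$. *)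

theory Defs
  imports Main
begin

text \<open>
  A position \<open>R\<^sup>p\<close> is a pair \<open>(R, p)\<close>, counted from 0, and a UID \<open>R\<^sup>p \<subseteq> S\<^sup>q\<close> is the pair
  \<open>(R\<^sup>p, S\<^sup>q)\<close>, so that a set of UIDs is a relation on positions. The signature is given
  by the arity function \<open>ar\<close>.
\<close>

type_synonym ('r, 'e) fact = "'r \<times> 'e list"
type_synonym 'r position = "'r \<times> nat"
type_synonym 'r uid = "'r position \<times> 'r position"

definition is_instance :: "('r \<Rightarrow> nat) \<Rightarrow> ('r, 'e) fact set \<Rightarrow> bool" where
  "is_instance ar I \<longleftrightarrow> (\<forall>(R, as) \<in> I. length as = ar R)"

definition dom_inst :: "('r, 'e) fact set \<Rightarrow> 'e set" where
  "dom_inst I = (\<Union>(R, as) \<in> I. set as)"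

definition occurs_at :: "('r, 'e) fact set \<Rightarrow> 'e \<Rightarrow> 'r position \<Rightarrow> bool" where
  "occurs_at I a P \<longleftrightarrow> (\<exists>as. (fst P, as) \<in> I \<and> snd P < length as \<and> as ! snd P = a)"

definition uid_set :: "('r \<Rightarrow> nat) \<Rightarrow> 'r uid set \<Rightarrow> bool" where
  "uid_set ar \<Sigma> \<longleftrightarrow> (\<forall>(P, Q) \<in> \<Sigma>. snd P < ar (fst P) \<and> snd Q < ar (fst Q) \<and> P \<noteq> Q)"

definition transitively_closed :: "'r uid set \<Rightarrow> bool" where
  "transitively_closed \<Sigma> \<longleftrightarrow>
     (\<forall>P Q T. (P, Q) \<in> \<Sigma> \<and> (Q, T) \<in> \<Sigma> \<and> P \<noteq> T \<longrightarrow> (P, T) \<in> \<Sigma>)"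

definition reversible :: "'r uid set \<Rightarrow> 'r uid \<Rightarrow> bool" where
  "reversible \<Sigma> \<tau> \<longleftrightarrow> \<tau> \<in> \<Sigma> \<and> (snd \<tau>, fst \<tau>) \<in> \<Sigma>"

definition ID_equiv :: "'r uid set \<Rightarrow> 'r position \<Rightarrow> 'r position \<Rightarrow> bool" where
  "ID_equiv \<Sigma> P Q \<longleftrightarrow> P = Q \<or> ((P, Q) \<in> \<Sigma> \<and> (Q, P) \<in> \<Sigma>)"

text \<open>
  A chase step is a pair \<open>(F', \<tau>)\<close> of the parent fact and the UID applied to it.
\<close>

type_synonym ('r, 'e) step = "('r, 'e) fact \<times> 'r uid"

definition exported_elem :: "('r, 'e) step \<Rightarrow> 'e" where
  "exported_elem s = snd (fst s) ! snd (fst (snd s))"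

definition exported_pos :: "('r, 'e) step \<Rightarrow> 'r position" where
  "exported_pos s = snd (snd s)"

definition applicable_steps :: "'r uid set \<Rightarrow> ('r, 'e) fact set \<Rightarrow> ('r, 'e) step set" where
  "applicable_steps \<Sigma> I =
     {(F, \<tau>). F \<in> I \<and> \<tau> \<in> \<Sigma> \<and> fst F = fst (fst \<tau>) \<and>
              \<not> occurs_at I (exported_elem (F, \<tau>)) (exported_pos (F, \<tau>))}"

definition new_fact ::
  "('r \<Rightarrow> nat) \<Rightarrow> (('r, 'e) step \<Rightarrow> nat \<Rightarrow> 'e) \<Rightarrow> ('r, 'e) step \<Rightarrow> ('r, 'e) fact" where
  "new_fact ar \<nu> s =
     (case exported_pos s of (S, q) \<Rightarrow>
        (S, map (\<lambda>j. if j = q then exported_elem s else \<nu> s j) [0..<ar S]))"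

text \<open>
  The chase is determined only up to the names of the nulls and the choice of the facts
  kept in the first round. Both are parameters: \<open>\<nu> s j\<close> is the null which step \<open>s\<close> creates
  at position \<open>j\<close> of its new fact, and \<open>K\<close> is the set of steps kept in the first round.
  A step is performed at most once, since after the round in which it is applicable
  its exported element does occur at its exported position; hence \<open>\<nu>\<close> need not depend on
  the round.
\<close>

context
  fixes ar :: "'r \<Rightarrow> nat"
    and I\<^sub>0 :: "('r, 'e) fact set"
    and \<Sigma> :: "'r uid set"
    and K :: "('r, 'e) step set"
    and \<nu> :: "('r, 'e) step \<Rightarrow> nat \<Rightarrow> 'e"
begin

primrec chase_round :: "nat \<Rightarrow> ('r, 'e) fact set" where
  "chase_round 0 = I\<^sub>0"
| "chase_round (Suc i) =
     chase_round i \<union>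
     new_fact ar \<nu> ` (if i = 0 then K else applicable_steps \<Sigma> (chase_round i))"

definition chase :: "('r, 'e) fact set" where
  "chase = (\<Union>i. chase_round i)"

definition chase_steps :: "('r, 'e) step set" where
  "chase_steps = K \<union> (\<Union>i \<in> {1..}. applicable_steps \<Sigma> (chase_round i))"

text \<open>The pairs \<open>(s, j)\<close> for which the chase creates the null \<open>\<nu> s j\<close>.\<close>

definition null_slots :: "(('r, 'e) step \<times> nat) set" where
  "null_slots =
     {(s, j). s \<in> chase_steps \<and> j < ar (fst (exported_pos s)) \<and> j \<noteq> snd (exported_pos s)}"

definition is_chase :: bool where
  "is_chase \<longleftrightarrow>
     K \<subseteq> applicable_steps \<Sigma> I\<^sub>0 \<and>
     (\<forall>s \<in> applicable_steps \<Sigma> I\<^sub>0. \<exists>!s'. s' \<in> K \<and>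
        exported_elem s' = exported_elem s \<and> exported_pos s' = exported_pos s) \<and>
     inj_on (\<lambda>(s, j). \<nu> s j) null_slots \<and>
     (\<forall>(s, j) \<in> null_slots. \<nu> s j \<notin> dom_inst I\<^sub>0)"

definition introduced_by :: "('r, 'e) step \<Rightarrow> 'e \<Rightarrow> 'r position \<Rightarrow> bool" where
  "introduced_by s c P \<longleftrightarrow>
     (s, snd P) \<in> null_slots \<and> fst P = fst (exported_pos s) \<and> c = \<nu> s (snd P)"

definition introduced_at :: "'e \<Rightarrow> 'r position \<Rightarrow> bool" where
  "introduced_at c P \<longleftrightarrow> (\<exists>s. introduced_by s c P)"

text \<open>
  \<open>last_uids c [\<tau>\<^sub>1, \<dots>, \<tau>\<^sub>n]\<close>: the last \<open>n\<close> UIDs of \<open>c\<close> are defined and are these.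
  The element reached after \<open>\<tau>\<^sub>n\<close> may lie in the initial instance.
\<close>

inductive last_uids :: "'e \<Rightarrow> 'r uid list \<Rightarrow> bool" where
  "last_uids c []"
| "introduced_by s c P \<Longrightarrow> last_uids (exported_elem s) \<tau>s \<Longrightarrow> last_uids c (snd s # \<tau>s)"

definition n_reversible :: "nat \<Rightarrow> 'e \<Rightarrow> bool" where
  "n_reversible n c \<longleftrightarrow>
     (\<exists>\<tau>s. last_uids c \<tau>s \<and> length \<tau>s = n \<and> (\<forall>\<tau> \<in> set \<tau>s. reversible \<Sigma> \<tau>))"

end

primrec bounded_sim ::
  "nat \<Rightarrow> ('r, 'e) fact set \<Rightarrow> 'e \<Rightarrow> ('r, 'f) fact set \<Rightarrow> 'f \<Rightarrow> bool" where
  "bounded_sim 0 I a I' b \<longleftrightarrow> True"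
| "bounded_sim (Suc m) I a I' b \<longleftrightarrow>
     (\<forall>R as p. (R, as) \<in> I \<and> p < length as \<and> as ! p = a \<longrightarrow>
        (\<exists>bs. (R, bs) \<in> I' \<and> length bs = length as \<and> bs ! p = b \<and>
              (\<forall>j < length as. bounded_sim m I (as ! j) I' (bs ! j))))"

definition bounded_bisim :: "nat \<Rightarrow> ('r, 'e) fact set \<Rightarrow> 'e \<Rightarrow> 'e \<Rightarrow> bool" where
  "bounded_bisim m I a b \<longleftrightarrow> bounded_sim m I a I b \<and> bounded_sim m I b I a"

text \<open>
  Every initial instance has a chase once the element type provides enough nulls,
  for instance Skolem terms over the original elements.
\<close>

datatype ('r, 'e) skolem = Const 'e | Null 'r "('r, 'e) skolem list" "'r uid" nat

lemma is_chase_exists: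
  fixes I\<^sub>0 :: "('r, ('r, 'e) skolem) fact set"
  assumes "dom_inst I\<^sub>0 \<subseteq> range Const"
  shows "\<exists>K \<nu>. is_chase ar I\<^sub>0 \<Sigma> K \<nu>"
proof -
  let ?A = "applicable_steps \<Sigma> I\<^sub>0"
  let ?key = "\<lambda>s. (exported_elem s, exported_pos s)"
  let ?K = "inv_into ?A ?key ` ?key ` ?A"
  let ?\<nu> = "\<lambda>s. Null (fst (fst s)) (snd (fst s)) (snd s)"
  have "?K \<subseteq> ?A"
    by (auto intro!: inv_into_into)
  moreover have "\<exists>!s'. s' \<in> ?K \<and> ?key s' = ?key s" if "s \<in> ?A" for s
  proof (rule ex1I[of _ "inv_into ?A ?key (?key s)"])
    show "inv_into ?A ?key (?key s) \<in> ?K \<and> ?key (inv_into ?A ?key (?key s)) = ?key s"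
      using f_inv_into_f[of "?key s" ?key ?A] that by blast
  next
    fix s' assume "s' \<in> ?K \<and> ?key s' = ?key s"
    then obtain k where "k \<in> ?key ` ?A" "s' = inv_into ?A ?key k" "?key s' = ?key s"
      by blast
    then show "s' = inv_into ?A ?key (?key s)"
      using f_inv_into_f[of k ?key ?A] by simp
  qed
  moreover have "inj_on (\<lambda>(s, j). ?\<nu> s j) B" for B
    by (auto simp: inj_on_def prod_eq_iff)
  moreover have "?\<nu> s j \<notin> dom_inst I\<^sub>0" for s j
    using assms by blast
  ultimately have "is_chase ar I\<^sub>0 \<Sigma> ?K ?\<nu>"
    unfolding is_chase_def by simp
  then show ?thesis by blast
qed

end

theory Submission
  imports Defs
begin

text \<open>
  By transitivity of the UIDs, a null \<open>c\<close> introduced at \<open>P\<close> occurs exactly in the fact \<open>F\<close> that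
  introduces it and, for each UID \<open>P \<subseteq> T\<close>, in one fact created by applying that UID to \<open>F\<close>;
  \<open>c\<close> is never exported again from the latter facts. Hence two facts created with the
  same exported position simulate each other as well as their exported elements do.
  Let \<open>a\<close> and \<open>b\<close> be reversible nulls introduced at equivalent positions \<open>P\<close> and \<open>Q\<close>. Their facts
  at a position \<open>T\<close> not equivalent to \<open>P\<close> have this form, and induction on \<open>n\<close> applies to
  the exported elements \<open>a\<close> and \<open>b\<close>. At a position equivalent to \<open>P\<close>, both facts are created
  by reversible UIDs, so each of their elements, the exported one included, is reversible and
  introduced at a position equivalent to the one where it stands; induction applies to all of them.
\<close>

section \<open>Facts, positions and bounded simulation\<close>

definition stands_at :: "('r, 'e) fact \<Rightarrow> 'e \<Rightarrow> 'r position \<Rightarrow> bool" where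
  "stands_at F c P \<longleftrightarrow> fst F = fst P \<and> snd P < length (snd F) \<and> snd F ! snd P = c"

lemma occurs_at_iff_stands_at: "occurs_at I c P \<longleftrightarrow> (\<exists>F \<in> I. stands_at F c P)"
  unfolding occurs_at_def stands_at_def by force

lemma fst_new_fact [simp]: "fst (new_fact ar \<nu> s) = fst (exported_pos s)"
  and length_new_fact [simp]: "length (snd (new_fact ar \<nu> s)) = ar (fst (exported_pos s))"
  by (auto simp: new_fact_def split: prod.split)

lemma nth_new_fact:
  assumes "j < ar (fst (exported_pos s))"
  shows "snd (new_fact ar \<nu> s) ! j = (if j = snd (exported_pos s) then exported_elem s else \<nu> s j)"
  using assms by (auto simp: new_fact_def split: prod.split)

lemma exported_pos_pair [simp]: "exported_pos (F, (P, Q)) = Q"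
  by (simp add: exported_pos_def)

lemma ID_equiv_sym: "ID_equiv \<Sigma> P Q \<Longrightarrow> ID_equiv \<Sigma> Q P"
  by (auto simp: ID_equiv_def)

lemma ID_equiv_trans:
  assumes "transitively_closed \<Sigma>" "ID_equiv \<Sigma> P Q" "ID_equiv \<Sigma> Q T"
  shows "ID_equiv \<Sigma> P T"
  using assms unfolding ID_equiv_def transitively_closed_def by metis

text \<open>Treats a fact as a unit, because the chase lemmas below speak of whole facts and of the
  steps that create them. Using the same \<open>P\<close> on both sides also forces equal relation
  symbols.\<close>

lemma bounded_sim_Suc_iff_stands_at:
  "bounded_sim (Suc m) I a I' b \<longleftrightarrow>
     (\<forall>F \<in> I. \<forall>P. stands_at F a P \<longrightarrow>
        (\<exists>G \<in> I'. stands_at G b P \<and> length (snd G) = length (snd F) \<and>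
           (\<forall>j < length (snd F). bounded_sim m I (snd F ! j) I' (snd G ! j))))"
  (is "?L \<longleftrightarrow> ?R")
proof
  assume L: ?L
  show ?R
  proof (intro ballI allI impI)
    fix F P assume "F \<in> I" "stands_at F a P"
    then obtain bs where "(fst P, bs) \<in> I'" "length bs = length (snd F)" "bs ! snd P = b"
      "\<forall>j < length (snd F). bounded_sim m I (snd F ! j) I' (bs ! j)"
      using L[unfolded bounded_sim.simps, rule_format, of "fst P" "snd F" "snd P"]
      by (auto simp: stands_at_def) (metis prod.collapse)
    with \<open>stands_at F a P\<close> show "\<exists>G \<in> I'. stands_at G b P \<and> length (snd G) = length (snd F) \<and>
           (\<forall>j < length (snd F). bounded_sim m I (snd F ! j) I' (snd G ! j))"
      by (intro bexI[of _ "(fst P, bs)"]) (auto simp: stands_at_def)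
  qed
next
  assume R: ?R
  show ?L
    unfolding bounded_sim.simps
  proof (intro allI impI)
    fix S as p assume "(S, as) \<in> I \<and> p < length as \<and> as ! p = a"
    then have "(S, as) \<in> I" "stands_at (S, as) a (S, p)"
      by (auto simp: stands_at_def)
    with R obtain G where "G \<in> I'" "stands_at G b (S, p)" "length (snd G) = length as"
      "\<forall>j < length as. bounded_sim m I (as ! j) I' (snd G ! j)"
      by fastforce
    then show "\<exists>bs. (S, bs) \<in> I' \<and> length bs = length as \<and> bs ! p = b \<and>
        (\<forall>j < length as. bounded_sim m I (as ! j) I' (bs ! j))"
      by (intro exI[of _ "snd G"]) (auto simp: stands_at_def)
  qed
qed

lemma bounded_sim_SucD: "bounded_sim (Suc m) I a I' b \<Longrightarrow> bounded_sim m I a I' b"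
proof (induction m arbitrary: a b)
  case (Suc m)
  show ?case
    unfolding bounded_sim_Suc_iff_stands_at
    using Suc.prems[unfolded bounded_sim_Suc_iff_stands_at[of "Suc m"]] Suc.IH by meson
qed simp

section \<open>Steps and rounds of the chase\<close>

locale uid_chase =
  fixes ar :: "'r \<Rightarrow> nat"
    and I\<^sub>0 :: "('r, 'e) fact set"
    and \<Sigma> :: "'r uid set"
    and K :: "('r, 'e) step set"
    and \<nu> :: "('r, 'e) step \<Rightarrow> nat \<Rightarrow> 'e"
  assumes inst: "is_instance ar I\<^sub>0"
    and uids: "uid_set ar \<Sigma>"
    and closed: "transitively_closed \<Sigma>"
    and is_chase: "is_chase ar I\<^sub>0 \<Sigma> K \<nu>"
begin

abbreviation "Round \<equiv> chase_round ar I\<^sub>0 \<Sigma> K \<nu>"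
abbreviation "Chase \<equiv> chase ar I\<^sub>0 \<Sigma> K \<nu>"
abbreviation "Steps \<equiv> chase_steps ar I\<^sub>0 \<Sigma> K \<nu>"
abbreviation "fact_of \<equiv> new_fact ar \<nu>"
abbreviation "intro_by \<equiv> introduced_by ar I\<^sub>0 \<Sigma> K \<nu>"
abbreviation "rev_elem \<equiv> n_reversible ar I\<^sub>0 \<Sigma> K \<nu>"

lemma uid_bounds:
  assumes "(P, Q) \<in> \<Sigma>"
  shows "snd P < ar (fst P)" "snd Q < ar (fst Q)" "P \<noteq> Q"
  using uids assms by (auto simp: uid_set_def)

lemma initial_steps: "K \<subseteq> applicable_steps \<Sigma> I\<^sub>0"
  using is_chase by (simp add: is_chase_def)

lemma applicable_stepD:
  assumes "t \<in> applicable_steps \<Sigma> I"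
  shows "fst t \<in> I" "snd t \<in> \<Sigma>" "fst (fst t) = fst (fst (snd t))"
    "\<not> occurs_at I (exported_elem t) (exported_pos t)"
  using assms by (auto simp: applicable_steps_def)

lemma step_applicable:
  assumes "t \<in> Steps"
  obtains i where "t \<in> applicable_steps \<Sigma> (Round i)" "fact_of t \<in> Round (Suc i)"
proof (cases "t \<in> K")
  case True
  then show ?thesis using that[of 0] initial_steps by auto
next
  case False
  then show ?thesis using assms that by (force simp: chase_steps_def)
qed

text \<open>Hides the special first round: the steps in \<open>K\<close> are applicable and belong
  to \<open>Steps\<close>, just like those of later rounds.\<close>

lemma Round_SucE:
  assumes "F \<in> Round (Suc i)"
  obtains "F \<in> Round i"
  | t where "F = fact_of t" "t \<in> Steps" "t \<in> applicable_steps \<Sigma> (Round i)"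
proof (cases "i = 0")
  case True
  then show ?thesis using assms that initial_steps by (auto simp: chase_steps_def)
next
  case False
  then show ?thesis using assms that by (force simp: chase_steps_def)
qed

lemma length_Round: "F \<in> Round i \<Longrightarrow> length (snd F) = ar (fst F)"
proof (induction i arbitrary: F)
  case 0
  then show ?case using inst by (auto simp: is_instance_def)
next
  case (Suc i)
  from Suc.prems show ?case
    by (cases rule: Round_SucE) (auto simp: Suc.IH)
qed

lemma fact_of_in_Chase: "t \<in> Steps \<Longrightarrow> fact_of t \<in> Chase"
  by (metis step_applicable chase_def UN_I UNIV_I)

lemma step_uid: "t \<in> Steps \<Longrightarrow> snd t \<in> \<Sigma>"
  by (metis step_applicable applicable_stepD(2))

lemma exported_pos_bound: "t \<in> Steps \<Longrightarrow> snd (exported_pos t) < ar (fst (exported_pos t))"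
  using step_uid[of t] uid_bounds(2)[of "fst (snd t)" "snd (snd t)"]
  by (simp add: exported_pos_def)

lemma stands_at_exported:
  "t \<in> Steps \<Longrightarrow> stands_at (fact_of t) (exported_elem t) (exported_pos t)"
  by (simp add: stands_at_def exported_pos_bound nth_new_fact)

lemma parent_stands_at:
  assumes "t \<in> applicable_steps \<Sigma> (Round i)"
  shows "stands_at (fst t) (exported_elem t) (fst (snd t))"
  using applicable_stepD[OF assms] length_Round uid_bounds(1)[of "fst (snd t)" "snd (snd t)"]
  by (simp add: stands_at_def exported_elem_def)

section \<open>Nulls and the facts that contain them\<close>

lemma intro_by_stepD:
  assumes "intro_by s c P"
  shows "s \<in> Steps" "stands_at (fact_of s) c P" "P \<noteq> exported_pos s"
  using assms by (auto simp: introduced_by_def null_slots_def stands_at_def nth_new_fact)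

text \<open>Injectivity of \<open>\<nu>\<close> on the slots gives the step and the index; the
  relation symbol is then that of the exported position of the step.\<close>

lemma intro_by_unique:
  assumes "intro_by s c P" "intro_by t c Q"
  shows "t = s" "Q = P"
proof -
  have "inj_on (\<lambda>(s, j). \<nu> s j) (null_slots ar I\<^sub>0 \<Sigma> K \<nu>)"
    using is_chase by (simp add: is_chase_def)
  then have "(s, snd P) = (t, snd Q)"
    by (rule inj_onD) (use assms in \<open>auto simp: introduced_by_def\<close>)
  then show "t = s" "Q = P"
    using assms by (auto simp: introduced_by_def intro: prod_eqI)
qed

lemma intro_by_not_initial:
  assumes "intro_by s c P" "F \<in> I\<^sub>0"
  shows "\<not> stands_at F c Q"
proof
  assume "stands_at F c Q"
  then have "c \<in> set (snd F)"
    by (auto simp: stands_at_def)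
  then have "c \<in> dom_inst I\<^sub>0"
    using assms(2) by (auto simp: dom_inst_def case_prod_unfold)
  then show False
    using assms(1) is_chase by (auto simp: introduced_by_def is_chase_def)
qed

lemma stands_at_fact_ofE:
  assumes "t \<in> Steps" "stands_at (fact_of t) c Q"
  obtains "Q = exported_pos t" "c = exported_elem t" | "intro_by t c Q"
  using assms
  by (cases "snd Q = snd (exported_pos t)")
     (auto simp: stands_at_def nth_new_fact introduced_by_def null_slots_def prod_eq_iff)

text \<open>
  The third conjunct of the second case is the saturation that keeps \<open>c\<close> from being exported a
  second time; it makes the property inductive along the rounds.
\<close>

definition confined :: "('r, 'e) step \<Rightarrow> 'e \<Rightarrow> 'r position \<Rightarrow> ('r, 'e) fact set \<Rightarrow> bool" where
  "confined s c P I \<longleftrightarrow> (\<forall>F \<in> I. \<forall>Q. stands_at F c Q \<longrightarrow>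
     (F = fact_of s \<and> Q = P) \<or>
     ((fact_of s, (P, Q)) \<in> Steps \<and> F = fact_of (fact_of s, (P, Q)) \<and>
      (\<forall>T. T = P \<or> (P, T) \<in> \<Sigma> \<longrightarrow> occurs_at I c T)))"

text \<open>If the parent were a fact created by \<open>P \<subseteq> P'\<close> instead of the
  introducing fact, transitivity would make the new exported position equal to \<open>P\<close> or
  reachable from \<open>P\<close> by one UID. By saturation \<open>c\<close> already occurs there,
  so the step would not be applicable.\<close>

lemma exporting_step_if_confined:
  assumes c: "intro_by s c P" and conf: "confined s c P (Round i)"
    and t: "t \<in> applicable_steps \<Sigma> (Round i)" "exported_elem t = c"
  shows "t = (fact_of s, (P, exported_pos t))"
proof -
  let ?P' = "fst (snd t)"
  note t' = applicable_stepD[OF t(1)]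
  have Q: "snd t = (?P', exported_pos t)"
    by (simp add: exported_pos_def)
  have "stands_at (fst t) c ?P'"
    using parent_stands_at[OF t(1)] t(2) by simp
  then consider "fst t = fact_of s" "?P' = P"
    | "(fact_of s, (P, ?P')) \<in> Steps" "\<forall>T. T = P \<or> (P, T) \<in> \<Sigma> \<longrightarrow> occurs_at (Round i) c T"
    using conf t'(1) unfolding confined_def by blast
  then show ?thesis
  proof cases
    case 1
    then show ?thesis using Q by (metis prod.collapse)
  next
    case 2
    have "(P, ?P') \<in> \<Sigma>" using step_uid[OF 2(1)] by simp
    moreover have "(?P', exported_pos t) \<in> \<Sigma>" using t'(2) Q by simp
    ultimately have "exported_pos t = P \<or> (P, exported_pos t) \<in> \<Sigma>"
      using closed unfolding transitively_closed_def by metis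
    then show ?thesis using 2(2) t'(4) t(2) by blast
  qed
qed

lemma introducing_fact_saturates:
  assumes c: "intro_by s c P" and F: "fact_of s \<in> Round i" and T: "(P, T) \<in> \<Sigma>"
  shows "occurs_at (Round (Suc i)) c T"
proof (cases "occurs_at (Round i) c T")
  case True
  then show ?thesis by (auto simp: occurs_at_def)
next
  case False
  let ?t = "(fact_of s, (P, T))"
  have P: "stands_at (fact_of s) c P" using intro_by_stepD(2)[OF c] .
  \<comment> \<open>A null is absent from \<open>I\<^sub>0\<close>, so the next round is not the
    first one and performs every applicable step, not only those in \<open>K\<close>.\<close>
  have i: "i \<noteq> 0"
    using intro_by_not_initial[OF c] F P by (metis chase_round.simps(1))
  have e: "exported_elem ?t = c"
    using P by (simp add: stands_at_def exported_elem_def)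
  have app: "?t \<in> applicable_steps \<Sigma> (Round i)"
    using F T False P e by (simp add: applicable_steps_def stands_at_def)
  then have "?t \<in> Steps" "fact_of ?t \<in> Round (Suc i)"
    using i by (auto simp: chase_steps_def intro!: bexI[of _ i])
  then show ?thesis
    using stands_at_exported[of ?t] e unfolding occurs_at_iff_stands_at by auto
qed

lemma confined_Round:
  assumes c: "intro_by s c P"
  shows "confined s c P (Round i)"
proof (induction i)
  case 0
  then show ?case
    using intro_by_not_initial[OF c] by (simp add: confined_def)
next
  case (Suc i)
  have mono: "occurs_at (Round i) c T \<Longrightarrow> occurs_at (Round (Suc i)) c T" for T
    by (auto simp: occurs_at_def)
  have sat: "\<forall>T. T = P \<or> (P, T) \<in> \<Sigma> \<longrightarrow> occurs_at (Round (Suc i)) c T"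
    if "\<forall>T. T = P \<or> (P, T) \<in> \<Sigma> \<longrightarrow> occurs_at (Round i) c T"
    using that mono by blast
  show ?case
    unfolding confined_def
  proof (intro ballI allI impI)
    fix F Q assume F: "F \<in> Round (Suc i)" and Q: "stands_at F c Q"
    let ?goal = "(F = fact_of s \<and> Q = P) \<or>
       ((fact_of s, (P, Q)) \<in> Steps \<and> F = fact_of (fact_of s, (P, Q)) \<and>
        (\<forall>T. T = P \<or> (P, T) \<in> \<Sigma> \<longrightarrow> occurs_at (Round (Suc i)) c T))"
    from F show ?goal
    proof (cases rule: Round_SucE)
      case 1
      then have "(F = fact_of s \<and> Q = P) \<or>
         ((fact_of s, (P, Q)) \<in> Steps \<and> F = fact_of (fact_of s, (P, Q)) \<and>
          (\<forall>T. T = P \<or> (P, T) \<in> \<Sigma> \<longrightarrow> occurs_at (Round i) c T))"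
        using Suc Q unfolding confined_def by blast
      then show ?thesis by (elim disj_forward conj_forward sat)
    next
      case (2 t)
      from 2(2) Q[unfolded 2(1)] show ?thesis
      proof (cases rule: stands_at_fact_ofE)
        case 1
        \<comment> \<open>Since \<open>c\<close> is exported by \<open>t\<close>, the parent is the
          introducing fact, which therefore lies in round \<open>i\<close>. The current round then
          fills all positions reachable from \<open>P\<close>, which yields the saturation
          conjunct.\<close>
        have t: "t = (fact_of s, (P, Q))"
          unfolding 1(1) using 1(2) by (intro exporting_step_if_confined[OF c Suc 2(3)]) simp
        then have R: "fact_of s \<in> Round i"
          using applicable_stepD(1)[OF 2(3)] by simp
        then have "occurs_at (Round i) c P"
          unfolding occurs_at_iff_stands_at using intro_by_stepD(2)[OF c] by (intro bexI)
        then have "\<forall>T. T = P \<or> (P, T) \<in> \<Sigma> \<longrightarrow> occurs_at (Round (Suc i)) c T"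
          using mono introducing_fact_saturates[OF c R] by blast
        then show ?thesis using 2(1,2) unfolding t by simp
      next
        case x: 2
        then show ?thesis using intro_by_unique[OF c x] 2(1) by simp
      qed
    qed
  qed
qed

text \<open>Serves to read off the UID of a step from the position where its exported element was
  introduced.\<close>

lemma exporting_step:
  assumes "intro_by s c P" "t \<in> Steps" "exported_elem t = c"
  shows "t = (fact_of s, (P, exported_pos t))"
proof -
  obtain i where "t \<in> applicable_steps \<Sigma> (Round i)"
    using step_applicable[OF assms(2)] by blast
  then show ?thesis
    using exporting_step_if_confined[OF assms(1) confined_Round[OF assms(1)]] assms(3) by blast
qed

lemma null_factE:
  assumes "intro_by s c P" "F \<in> Chase" "stands_at F c Q"
  obtains "F = fact_of s" "Q = P"
  | "(P, Q) \<in> \<Sigma>" "(fact_of s, (P, Q)) \<in> Steps" "F = fact_of (fact_of s, (P, Q))"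
proof -
  obtain i where "F \<in> Round i" using assms(2) by (auto simp: chase_def)
  then have "(F = fact_of s \<and> Q = P) \<or>
      ((fact_of s, (P, Q)) \<in> Steps \<and> F = fact_of (fact_of s, (P, Q)))"
    using confined_Round[OF assms(1), of i] assms(3) unfolding confined_def by blast
  then show ?thesis
    using that step_uid[of "(fact_of s, (P, Q))"] by auto
qed

text \<open>Saturation puts \<open>c\<close> at \<open>Q\<close> in some fact. As
  \<open>P \<noteq> Q\<close>, that fact is not the introducing one, and \<open>null_factE\<close>
  leaves only this step as its origin.\<close>

lemma null_step:
  assumes c: "intro_by s c P" and Q: "(P, Q) \<in> \<Sigma>"
  shows "(fact_of s, (P, Q)) \<in> Steps" "exported_elem (fact_of s, (P, Q)) = c"
proof -
  obtain i where "fact_of s \<in> Round i"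
    using fact_of_in_Chase[OF intro_by_stepD(1)[OF c]] by (auto simp: chase_def)
  then obtain F where "F \<in> Round (Suc i)" "stands_at F c Q"
    using introducing_fact_saturates[OF c _ Q] unfolding occurs_at_iff_stands_at by blast
  then have "F \<in> Chase" "stands_at F c Q" unfolding chase_def by blast+
  then show "(fact_of s, (P, Q)) \<in> Steps"
    using uid_bounds(3)[OF Q] by (cases rule: null_factE[OF c]) auto
  show "exported_elem (fact_of s, (P, Q)) = c"
    using intro_by_stepD(2)[OF c] by (simp add: stands_at_def exported_elem_def)
qed

section \<open>Facts created with the same exported position\<close>

abbreviation sim :: "nat \<Rightarrow> 'e \<Rightarrow> 'e \<Rightarrow> bool" where
  "sim m a b \<equiv> bounded_sim m Chase a Chase b"

text \<open>At the exported position the claim is the hypothesis. The nulls of \<open>s\<close> and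
  \<open>t\<close> with the same index are exported by the same UIDs, so every fact containing the
  former has a counterpart with the same exported position, to which the induction on
  \<open>m\<close> applies.\<close>

lemma sim_fact_of_same_exported_pos:
  assumes "s \<in> Steps" "t \<in> Steps" "exported_pos s = exported_pos t"
    and "sim m (exported_elem s) (exported_elem t)"
    and "j < ar (fst (exported_pos s))"
  shows "sim m (snd (fact_of s) ! j) (snd (fact_of t) ! j)"
  using assms
proof (induction m arbitrary: s t j)
  case (Suc m)
  note st = Suc.prems(1-3) and j = Suc.prems(5)
  have exp: "sim m (exported_elem s) (exported_elem t)"
    using Suc.prems(4) by (rule bounded_sim_SucD)
  show ?case
  proof (cases "j = snd (exported_pos s)")
    case True
    then show ?thesis using Suc.prems by (simp add: nth_new_fact)
  next
    case False
    let ?P = "(fst (exported_pos s), j)"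
    have eqs: "snd (fact_of s) ! j = \<nu> s j" "snd (fact_of t) ! j = \<nu> t j"
      using st j False by (simp_all add: nth_new_fact)
    have si: "intro_by s (\<nu> s j) ?P" and ti: "intro_by t (\<nu> t j) ?P"
      using st j False by (auto simp: introduced_by_def null_slots_def)
    \<comment> \<open>The induction hypothesis for these same steps serves twice: it matches the two
      introducing facts, and it relates the nulls at level \<open>m\<close>, as required once they
      are the exported elements of later steps.\<close>
    have here: "sim m (snd (fact_of s) ! k) (snd (fact_of t) ! k)"
      if "k < ar (fst (exported_pos s))" for k
      using Suc.IH[OF st exp that] .
    have "sim (Suc m) (\<nu> s j) (\<nu> t j)"
      unfolding bounded_sim_Suc_iff_stands_at
    proof (intro ballI allI impI)
      fix F Q assume F: "F \<in> Chase" "stands_at F (\<nu> s j) Q"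
      from si F show "\<exists>G \<in> Chase. stands_at G (\<nu> t j) Q \<and> length (snd G) = length (snd F) \<and>
           (\<forall>k < length (snd F). sim m (snd F ! k) (snd G ! k))"
      proof (cases rule: null_factE)
        case 1
        show ?thesis
        proof (intro bexI[of _ "fact_of t"] conjI allI impI)
          show "fact_of t \<in> Chase" using st(2) by (rule fact_of_in_Chase)
          show "stands_at (fact_of t) (\<nu> t j) Q" using intro_by_stepD(2)[OF ti] 1(2) by simp
          show "length (snd (fact_of t)) = length (snd F)" using 1(1) st(3) by simp
          show "sim m (snd F ! k) (snd (fact_of t) ! k)" if "k < length (snd F)" for k
            using here that 1(1) by simp
        qed
      next
        case 2
        let ?t = "(fact_of t, (?P, Q))"
        note t = null_step[OF ti 2(1)] and s = null_step[OF si 2(1)]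
        have "sim m (\<nu> s j) (\<nu> t j)" using here[OF j] eqs by simp
        then have "\<forall>k < ar (fst Q). sim m (snd F ! k) (snd (fact_of ?t) ! k)"
          using Suc.IH[OF s(1) t(1)] s(2) t(2) 2(3) by simp
        then show ?thesis
          using fact_of_in_Chase[OF t(1)] stands_at_exported[OF t(1)] t(2) 2(3)
          by (intro bexI[of _ "fact_of ?t"]) auto
      qed
    qed
    then show ?thesis using eqs by simp
  qed
qed simp

section \<open>Reversible elements and the facts they stand in\<close>

lemma rev_elem_SucE:
  assumes "rev_elem (Suc n) c"
  obtains s P where "intro_by s c P" "reversible \<Sigma> (snd s)" "rev_elem n (exported_elem s)"
proof -
  obtain \<tau>s where \<tau>s: "last_uids ar I\<^sub>0 \<Sigma> K \<nu> c \<tau>s" "length \<tau>s = Suc n"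
    "\<forall>\<tau> \<in> set \<tau>s. reversible \<Sigma> \<tau>"
    using assms by (auto simp: n_reversible_def)
  from \<tau>s(1) show ?thesis
  proof cases
    case 1
    then show ?thesis using \<tau>s(2) by simp
  next
    case (2 s P \<sigma>s)
    then have "rev_elem n (exported_elem s)"
      unfolding n_reversible_def using \<tau>s by (intro exI[of _ \<sigma>s]) auto
    then show ?thesis using that[OF 2(2)] 2(1) \<tau>s(3) by simp
  qed
qed

lemma rev_elem_SucI:
  assumes "intro_by s c P" "reversible \<Sigma> (snd s)" "rev_elem n (exported_elem s)"
  shows "rev_elem (Suc n) c"
proof -
  obtain \<tau>s where "last_uids ar I\<^sub>0 \<Sigma> K \<nu> (exported_elem s) \<tau>s" "length \<tau>s = n"
    "\<forall>\<tau> \<in> set \<tau>s. reversible \<Sigma> \<tau>"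
    using assms(3) by (auto simp: n_reversible_def)
  then show ?thesis
    unfolding n_reversible_def using assms last_uids.intros(2)[OF assms(1)]
    by (intro exI[of _ "snd s # \<tau>s"]) auto
qed

lemma rev_elem_0: "rev_elem 0 c"
  by (auto simp: n_reversible_def intro: last_uids.intros)

lemma rev_elem_SucD: "rev_elem (Suc n) c \<Longrightarrow> rev_elem n c"
proof (induction n arbitrary: c)
  case (Suc n)
  then show ?case by (meson rev_elem_SucE rev_elem_SucI)
qed (rule rev_elem_0)

text \<open>A null created by \<open>s\<close> prepends the reversible UID of \<open>s\<close> to
  the UIDs of the exported element, so it is at least as reversible. The exported element is itself
  a null, since its index \<open>Suc n\<close> is positive.\<close>

lemma reversible_fact_element:
  assumes s: "s \<in> Steps" "reversible \<Sigma> (snd s)" "rev_elem (Suc n) (exported_elem s)"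
    and j: "j < ar (fst (exported_pos s))"
  obtains u P where "intro_by u (snd (fact_of s) ! j) P"
    "ID_equiv \<Sigma> P (fst (exported_pos s), j)" "rev_elem (Suc n) (snd (fact_of s) ! j)"
proof (cases "j = snd (exported_pos s)")
  case True
  obtain u P where u: "intro_by u (exported_elem s) P"
    using s(3) by (rule rev_elem_SucE)
  have "snd s = (P, exported_pos s)"
    using exporting_step[OF u s(1) refl] by (metis snd_conv)
  then have "ID_equiv \<Sigma> P (exported_pos s)"
    using s(2) by (simp add: reversible_def ID_equiv_def)
  then show ?thesis using that u s(3) True j by (simp add: nth_new_fact)
next
  case False
  have "intro_by s (\<nu> s j) (fst (exported_pos s), j)"
    using s(1) j False by (auto simp: introduced_by_def null_slots_def)
  then show ?thesis
    using that[of s] rev_elem_SucI[OF _ s(2)] rev_elem_SucD[OF s(3)] s(3) False j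
    by (auto simp: nth_new_fact ID_equiv_def intro: rev_elem_SucD)
qed

text \<open>Covers uniformly the two ways in which \<open>c\<close> can stand at \<open>T\<close>:
  as a null created by \<open>s\<close> or as the element exported by \<open>s\<close>.\<close>

definition reversibly_created_at :: "nat \<Rightarrow> 'e \<Rightarrow> 'r position \<Rightarrow> ('r, 'e) step \<Rightarrow> bool" where
  "reversibly_created_at n c T s \<longleftrightarrow> s \<in> Steps \<and> stands_at (fact_of s) c T \<and>
     reversible \<Sigma> (snd s) \<and> rev_elem n (exported_elem s)"

text \<open>For \<open>T = P\<close> the introducing step works, and its exported element has one
  level of reversibility less than \<open>c\<close> guarantees. Otherwise
  \<open>P \<subseteq> T\<close> is reversible and exports \<open>c\<close> itself.\<close>

lemma reversibly_created_at_exists: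
  assumes c: "intro_by s c P" and rev: "rev_elem (Suc n) c" and T: "ID_equiv \<Sigma> P T"
  obtains t where "reversibly_created_at n c T t"
proof (cases "P = T")
  case True
  obtain t Q where "intro_by t c Q" "reversible \<Sigma> (snd t)" "rev_elem n (exported_elem t)"
    using rev by (rule rev_elem_SucE)
  then have "reversibly_created_at n c T s"
    using True c intro_by_unique[OF c] intro_by_stepD[OF c]
    by (auto simp: reversibly_created_at_def)
  then show ?thesis by (rule that)
next
  case False
  then have PT: "(P, T) \<in> \<Sigma>" "(T, P) \<in> \<Sigma>" using T by (auto simp: ID_equiv_def)
  let ?t = "(fact_of s, (P, T))"
  note t = null_step[OF c PT(1)]
  have "reversibly_created_at n c T ?t"
    using t stands_at_exported[OF t(1)] PT rev_elem_SucD[OF rev]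
    by (simp add: reversibly_created_at_def reversible_def)
  then show ?thesis by (rule that)
qed

text \<open>Lets an arbitrary fact with \<open>c\<close> at \<open>T\<close> be identified with one
  whose creating step is known to be reversible.\<close>

lemma null_fact_unique:
  assumes "intro_by s c P" "F \<in> Chase" "G \<in> Chase" "stands_at F c T" "stands_at G c T"
  shows "F = G"
proof -
  have "H = (if T = P then fact_of s else fact_of (fact_of s, (P, T)))"
    if "H \<in> Chase" "stands_at H c T" for H
    using that uid_bounds(3)[of P T] by (cases rule: null_factE[OF assms(1)]) auto
  then show ?thesis using assms(2-5) by metis
qed

section \<open>Simulation of reversible nulls\<close>

lemma sim_if_reversible:
  assumes "intro_by s a P" "intro_by t b Q" "ID_equiv \<Sigma> P Q" "rev_elem n a" "rev_elem n b"
  shows "sim n a b"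
  using assms
proof (induction n arbitrary: a b P Q s t)
  case (Suc n)
  note a = Suc.prems(1) and b = Suc.prems(2) and PQ = Suc.prems(3)
    and ra = Suc.prems(4) and rb = Suc.prems(5)
  have ab: "sim n a b"
    using Suc.IH[OF a b PQ] ra rb by (auto dest: rev_elem_SucD)
  show ?case
    unfolding bounded_sim_Suc_iff_stands_at
  proof (intro ballI allI impI)
    fix F T assume F: "F \<in> Chase" "stands_at F a T"
    have "\<exists>s' t'. s' \<in> Steps \<and> t' \<in> Steps \<and> F = fact_of s' \<and> stands_at (fact_of t') b T \<and>
      (\<forall>j < length (snd F). sim n (snd (fact_of s') ! j) (snd (fact_of t') ! j))"
    proof (cases "ID_equiv \<Sigma> P T")
      case True
      then have QT: "ID_equiv \<Sigma> Q T"
        using ID_equiv_trans[OF closed ID_equiv_sym[OF PQ]] by blast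
      obtain s' where s': "reversibly_created_at n a T s'"
        using reversibly_created_at_exists[OF a ra True] .
      obtain t' where t': "reversibly_created_at n b T t'"
        using reversibly_created_at_exists[OF b rb QT] .
      note S = s'[unfolded reversibly_created_at_def] and T' = t'[unfolded reversibly_created_at_def]
      have Fs: "F = fact_of s'"
        using null_fact_unique[OF a F(1) _ F(2)] fact_of_in_Chase S by blast
      have rel: "fst (exported_pos s') = fst T" "fst (exported_pos t') = fst T"
        using S T' by (auto simp: stands_at_def)
      have "sim n (snd (fact_of s') ! j) (snd (fact_of t') ! j)" if "j < length (snd F)" for j
      \<comment> \<open>Level 0 is trivial; a positive \<open>n\<close> ensures that the exported
        elements are introduced nulls, as \<open>reversible_fact_element\<close> requires.\<close>
      proof (cases n)
        case (Suc k)
        have j: "j < ar (fst (exported_pos s'))" "j < ar (fst (exported_pos t'))"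
          using that Fs rel by auto
        obtain u U where u: "intro_by u (snd (fact_of s') ! j) U"
          "ID_equiv \<Sigma> U (fst T, j)" "rev_elem n (snd (fact_of s') ! j)"
          using reversible_fact_element[of s' k j] S j rel Suc by metis
        obtain v V where v: "intro_by v (snd (fact_of t') ! j) V"
          "ID_equiv \<Sigma> V (fst T, j)" "rev_elem n (snd (fact_of t') ! j)"
          using reversible_fact_element[of t' k j] T' j rel Suc by metis
        \<comment> \<open>\<open>U\<close> and \<open>V\<close> are both equivalent to the position
          where the two elements stand, hence to each other.\<close>
        show ?thesis
          using Suc.IH[OF u(1) v(1) ID_equiv_trans[OF closed u(2) ID_equiv_sym[OF v(2)]] u(3) v(3)] .
      qed simp
      then show ?thesis using S T' Fs by blast
    next
      case False
      let ?s = "(fact_of s, (P, T))" and ?t = "(fact_of t, (Q, T))"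
      have PT: "(P, T) \<in> \<Sigma>" and Fs: "F = fact_of ?s"
        using F False by (cases rule: null_factE[OF a]; auto simp: ID_equiv_def)+
      \<comment> \<open>\<open>T\<close> differs from \<open>Q\<close> because it is not equivalent
        to \<open>P\<close>; so either \<open>P = Q\<close> or transitivity applies to
        \<open>Q \<subseteq> P\<close> and \<open>P \<subseteq> T\<close>.\<close>
      have QT: "(Q, T) \<in> \<Sigma>"
        using PQ PT False closed unfolding ID_equiv_def transitively_closed_def by metis
      note s' = null_step[OF a PT] and t' = null_step[OF b QT]
      have "\<forall>j < length (snd F). sim n (snd (fact_of ?s) ! j) (snd (fact_of ?t) ! j)"
        using sim_fact_of_same_exported_pos[OF s'(1) t'(1)] s'(2) t'(2) ab Fs by simp
      then show ?thesis
        using s'(1) t' Fs stands_at_exported[OF t'(1)]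
        by (intro exI[of _ ?s] exI[of _ ?t]) simp
    qed
    then obtain s' t' where st: "t' \<in> Steps" "F = fact_of s'" "stands_at (fact_of t') b T"
      "\<forall>j < length (snd F). sim n (snd F ! j) (snd (fact_of t') ! j)"
      by blast
    moreover have "length (snd (fact_of t')) = length (snd F)"
      using st F(2) by (auto simp: stands_at_def)
    ultimately show "\<exists>G \<in> Chase. stands_at G b T \<and> length (snd G) = length (snd F) \<and>
         (\<forall>j < length (snd F). sim n (snd F ! j) (snd G ! j))"
      using fact_of_in_Chase by blast
  qed
qed simp

end

theorem mainTheorem4:
  fixes ar :: "'r \<Rightarrow> nat"
    and I\<^sub>0 :: "('r, 'e) fact set"
    and \<Sigma> :: "'r uid set"
    and K :: "('r, 'e) step set"
    and \<nu> :: "('r, 'e) step \<Rightarrow> nat \<Rightarrow> 'e"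
    and n :: nat
    and a b :: 'e
    and P Q :: "'r position"
  assumes "is_instance ar I\<^sub>0"
    and "uid_set ar \<Sigma>"
    and "transitively_closed \<Sigma>"
    and "is_chase ar I\<^sub>0 \<Sigma> K \<nu>"
    and "introduced_at ar I\<^sub>0 \<Sigma> K \<nu> a P"
    and "introduced_at ar I\<^sub>0 \<Sigma> K \<nu> b Q"
    and "ID_equiv \<Sigma> P Q"
    and "n_reversible ar I\<^sub>0 \<Sigma> K \<nu> n a"
    and "n_reversible ar I\<^sub>0 \<Sigma> K \<nu> n b"
  shows "bounded_bisim n (chase ar I\<^sub>0 \<Sigma> K \<nu>) a b"
proof -
  interpret uid_chase ar I\<^sub>0 \<Sigma> K \<nu>
    using assms(1-4) by (rule uid_chase.intro)
  obtain s t where "intro_by s a P" "intro_by t b Q"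
    using assms(5,6) by (auto simp: introduced_at_def)
  then show ?thesis
    unfolding bounded_bisim_def
    using sim_if_reversible ID_equiv_sym assms(7-9) by blast
qed

end
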